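(* In each of the cases S and L described in the context, every superalgebraic set is uniquely a finite union of irreducible components. That is, if $V\subseteq X$ is a superalgebraic set and $I=\mathcal I_{\mathcal A}(V)$, then there are only finitely many prime ideals $P_1,\dots,P_r$ of $\mathcal A$ minimal over $I$, each irreducible component $\mathcal V(P_i)$ is an irreducible superalgebraic set, $V=\mathcal V(P_1)\cup\dots\cup\mathcal V(P_r)$, and this is, up to order, the unique expression of $V$ as an irredundant finite union of irreducible superalgebraic sets.
   Context: Let $\mathtt k$ be an algebraically closed field of characteristic zero, let $m,n\ge 0$ be integers, and let $W=\mathcal S_m\times \mathcal S_n$ (product of symmetric groups) act on polynomials or Laurent polynomials in $x_1,\dots,x_m,y_1,\dots,y_n$ by permuting the $x_i$ and the $y_j$ separately. Case S: $X=\mathtt k^m\times\mathtt k^n$, and $\mathcal A$ is the algebra of supersymmetric polynomials over $\mathtt k$, i.e. of all $f\in \mathtt k[x_1,\dots,x_m,y_1,\dots,y_n]^{W}$ such that the polynomial obtained by substituting $x_1=t$, $y_1=-t$ is independent of $t$. Case L: $X=(\mathtt k^* )^m\times(\mathtt k^* )^n$, and $\mathcal A$ is the algebra of all $f\in \mathtt k[x_1^{\pm1},\dots,x_m^{\pm1},y_1^{\pm1},\dots,y_n^{\pm1}]^{W}$ such that $x_i\frac{\partial f}{\partial x_i}+y_j\frac{\partial f}{\partial y_j}$ lies in the ideal $(x_i-y_j)$ of the Laurent polynomial ring for all $i,j$. If $mn=0$ the supersymmetry condition is vacuous. For $I\subseteq \mathcal A$ put $\mathcal V(I)=\{x\in X: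 f(x)=0 \text{ for all } f\in I\}$; sets of this form are called superalgebraic sets. For $V\subseteq X$ put $\mathcal I_{\mathcal A}(V)=\{f\in\mathcal A: f(x)=0\text{ for all }x\in V\}$. A nonempty superalgebraic set is irreducible if it cannot be written as the union of two proper superalgebraic subsets. If $I$ is a radical ideal of $\mathcal A$, the irreducible components of $\mathcal V(I)$ are the sets $\mathcal V(P)$ for $P$ a prime ideal of $\mathcal A$ minimal over $I$. *)

theory Defs
  imports "HOL-Library.Poly_Mapping" "HOL-Algebra.Algebraic_Closure_Type"
begin

(* Inl i and Inr j stand for the variables x_(i+1) and y_(j+1): indices start at 0.  The types
   contain variables with arbitrarily large indices; the carriers below admit only i < m, j < n. *)
type_synonym var = "nat + nat"
type_synonym 'k mpoly = "(var \<Rightarrow>\<^sub>0 nat) \<Rightarrow>\<^sub>0 'k"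
type_synonym 'k laurent = "(var \<Rightarrow>\<^sub>0 int) \<Rightarrow>\<^sub>0 'k"
type_synonym 'k point = "(nat \<Rightarrow> 'k) \<times> (nat \<Rightarrow> 'k)"

definition vars :: "nat \<Rightarrow> nat \<Rightarrow> var set" where
  "vars m n = Inl ` {..<m} \<union> Inr ` {..<n}"

definition in_vars :: "nat \<Rightarrow> nat \<Rightarrow> ((var \<Rightarrow>\<^sub>0 'e::zero) \<Rightarrow>\<^sub>0 'k::zero) \<Rightarrow> bool" where
  "in_vars m n f \<longleftrightarrow> (\<forall>e\<in>Poly_Mapping.keys f. Poly_Mapping.keys e \<subseteq> vars m n)"

definition const :: "'k \<Rightarrow> (var \<Rightarrow>\<^sub>0 'e::zero) \<Rightarrow>\<^sub>0 'k::zero" where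
  "const c = Poly_Mapping.single 0 c"

definition var :: "var \<Rightarrow> (var \<Rightarrow>\<^sub>0 'e::zero_neq_one) \<Rightarrow>\<^sub>0 'k::zero_neq_one" where
  "var v = Poly_Mapping.single (Poly_Mapping.single v 1) 1"

(* For a permutation \<pi> of the variables this sends the monomial with exponents e to the one with
   exponents e \<circ> inv \<pi>, i.e. it replaces each variable v by \<pi> v: the coefficient of
   permute_vars \<pi> f at e is the coefficient of f at e \<circ> \<pi>. *)
definition permute_vars ::
  "(var \<Rightarrow> var) \<Rightarrow> ((var \<Rightarrow>\<^sub>0 'e::zero) \<Rightarrow>\<^sub>0 'k::zero) \<Rightarrow> ((var \<Rightarrow>\<^sub>0 'e) \<Rightarrow>\<^sub>0 'k)" where
  "permute_vars \<pi> f = Poly_Mapping.map_key (Poly_Mapping.map_key \<pi>) f"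

definition doubly_symmetric ::
  "nat \<Rightarrow> nat \<Rightarrow> ((var \<Rightarrow>\<^sub>0 'e::zero) \<Rightarrow>\<^sub>0 'k::zero) \<Rightarrow> bool" where
  "doubly_symmetric m n f \<longleftrightarrow>
     (\<forall>\<sigma> \<tau>. \<sigma> permutes {..<m} \<longrightarrow> \<tau> permutes {..<n} \<longrightarrow> permute_vars (map_sum \<sigma> \<tau>) f = f)"


subsection \<open>Case S: supersymmetric polynomials\<close>

(* Substitution of s v for every variable v, with coefficients mapped by h. *)
definition substitute ::
  "('k \<Rightarrow> 'r) \<Rightarrow> (var \<Rightarrow> 'r) \<Rightarrow> ('k::zero) mpoly \<Rightarrow> 'r::comm_semiring_1" where
  "substitute h s f = (\<Sum>e\<in>Poly_Mapping.keys f. h (Poly_Mapping.lookup f e) *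
     (\<Prod>v\<in>Poly_Mapping.keys e. s v ^ Poly_Mapping.lookup e v))"

(* The result of x_1 = t, y_1 = -t, as a univariate polynomial in t over the polynomial ring
   containing the remaining variables. *)
definition super_specialize :: "('k::comm_ring_1) mpoly \<Rightarrow> 'k mpoly poly" where
  "super_specialize f = substitute (\<lambda>c. [:const c:])
     (\<lambda>v. if v = Inl 0 then [:0, 1:] else if v = Inr 0 then - [:0, 1:] else [:var v:]) f"

definition algebra_S :: "nat \<Rightarrow> nat \<Rightarrow> ('k::comm_ring_1) mpoly ring" where
  "algebra_S m n = ring_of_type_algebra\<lparr>carrier := {f. in_vars m n f \<and> doubly_symmetric m n f \<and>
     (m > 0 \<and> n > 0 \<longrightarrow> Polynomial.degree (super_specialize f) = 0)}\<rparr>"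

(* Points are extensional functions (undefined outside the index set), so that distinct points
   of the type are distinct points of k^m \<times> k^n. *)
definition space_S :: "nat \<Rightarrow> nat \<Rightarrow> 'k point set" where
  "space_S m n = ({..<m} \<rightarrow>\<^sub>E UNIV) \<times> ({..<n} \<rightarrow>\<^sub>E UNIV)"

definition eval_S :: "('k::comm_ring_1) mpoly \<Rightarrow> 'k point \<Rightarrow> 'k" where
  "eval_S f p = substitute (\<lambda>c. c) (case_sum (fst p) (snd p)) f"


subsection \<open>Case L: supersymmetric Laurent polynomials\<close>

definition laurent_ring :: "nat \<Rightarrow> nat \<Rightarrow> ('k::comm_ring_1) laurent ring" where
  "laurent_ring m n = ring_of_type_algebra\<lparr>carrier := {f. in_vars m n f}\<rparr>"

definition partial_deriv :: "var \<Rightarrow> ('k::comm_ring_1) laurent \<Rightarrow> 'k laurent" where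
  "partial_deriv v f = (\<Sum>e\<in>Poly_Mapping.keys f. Poly_Mapping.single (e - Poly_Mapping.single v 1)
     (of_int (Poly_Mapping.lookup e v) * Poly_Mapping.lookup f e))"

definition algebra_L :: "nat \<Rightarrow> nat \<Rightarrow> ('k::comm_ring_1) laurent ring" where
  "algebra_L m n = ring_of_type_algebra\<lparr>carrier := {f. in_vars m n f \<and> doubly_symmetric m n f \<and>
     (\<forall>i<m. \<forall>j<n. var (Inl i) * partial_deriv (Inl i) f + var (Inr j) * partial_deriv (Inr j) f
        \<in> PIdl\<^bsub>laurent_ring m n\<^esub> (var (Inl i) - var (Inr j)))}\<rparr>"

definition space_L :: "nat \<Rightarrow> nat \<Rightarrow> ('k::zero) point set" where
  "space_L m n = ({..<m} \<rightarrow>\<^sub>E UNIV - {0}) \<times> ({..<n} \<rightarrow>\<^sub>E UNIV - {0})"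

definition eval_L :: "('k::field) laurent \<Rightarrow> 'k point \<Rightarrow> 'k" where
  "eval_L f p = (\<Sum>e\<in>Poly_Mapping.keys f. Poly_Mapping.lookup f e *
     (\<Prod>v\<in>Poly_Mapping.keys e. case_sum (fst p) (snd p) v powi Poly_Mapping.lookup e v))"


subsection \<open>Superalgebraic sets\<close>

text \<open>
  Both cases are instances of the following, where \<open>R\<close> is the algebra, \<open>\<X>\<close> the ambient space
  and \<open>ev f x\<close> the value of \<open>f\<close> at \<open>x\<close>.
\<close>

definition zero_locus :: "'p set \<Rightarrow> ('a \<Rightarrow> 'p \<Rightarrow> 'k::zero) \<Rightarrow> 'a set \<Rightarrow> 'p set" where
  "zero_locus \<X> ev I = {x\<in>\<X>. \<forall>f\<in>I. ev f x = 0}"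

definition vanishing_ideal :: "'a ring \<Rightarrow> ('a \<Rightarrow> 'p \<Rightarrow> 'k::zero) \<Rightarrow> 'p set \<Rightarrow> 'a set" where
  "vanishing_ideal R ev V = {f\<in>carrier R. \<forall>x\<in>V. ev f x = 0}"

definition superalgebraic ::
  "'a ring \<Rightarrow> 'p set \<Rightarrow> ('a \<Rightarrow> 'p \<Rightarrow> 'k::zero) \<Rightarrow> 'p set \<Rightarrow> bool" where
  "superalgebraic R \<X> ev V \<longleftrightarrow> (\<exists>I\<subseteq>carrier R. V = zero_locus \<X> ev I)"

definition irreducible_superalgebraic ::
  "'a ring \<Rightarrow> 'p set \<Rightarrow> ('a \<Rightarrow> 'p \<Rightarrow> 'k::zero) \<Rightarrow> 'p set \<Rightarrow> bool" where
  "irreducible_superalgebraic R \<X> ev V \<longleftrightarrow> superalgebraic R \<X> ev V \<and> V \<noteq> {} \<and>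
     \<not> (\<exists>V1 V2. superalgebraic R \<X> ev V1 \<and> superalgebraic R \<X> ev V2 \<and>
           V1 \<subset> V \<and> V2 \<subset> V \<and> V = V1 \<union> V2)"

definition minimal_primes_over :: "'a ring \<Rightarrow> 'a set \<Rightarrow> 'a set set" where
  "minimal_primes_over R I = {P. primeideal P R \<and> I \<subseteq> P \<and>
     \<not> (\<exists>Q. primeideal Q R \<and> I \<subseteq> Q \<and> Q \<subset> P)}"

definition irredundant_irreducible_decomposition ::
  "'a ring \<Rightarrow> 'p set \<Rightarrow> ('a \<Rightarrow> 'p \<Rightarrow> 'k::zero) \<Rightarrow> 'p set set \<Rightarrow> 'p set \<Rightarrow> bool" where
  "irredundant_irreducible_decomposition R \<X> ev \<C> V \<longleftrightarrow>
     finite \<C> \<and> (\<forall>C\<in>\<C>. irreducible_superalgebraic R \<X> ev C) \<and> V = \<Union>\<C> \<and>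
     (\<forall>C\<in>\<C>. V \<noteq> \<Union>(\<C> - {C}))"

end

theory Submission
  imports Defs
begin

section \<open>Irreducible components of superalgebraic sets\<close>

text \<open>
  The algebra \<open>\<A>\<close> need not be Noetherian, but it is a subring of a (Laurent) polynomial ring in
  finitely many variables, which is, and a strictly descending chain of superalgebraic sets yields a
  strictly ascending chain of ideals of vanishing (Laurent) polynomials. So the superalgebraic sets
  satisfy the descending chain condition, and each of them, \<open>V\<close>, is a finite irredundant union of
  irreducible ones \<open>C\<close>. Their vanishing ideals are prime, and a prime
  containing \<open>\<I>(V) = \<Inter>\<I>(C)\<close> contains some \<open>\<I>(C)\<close>; hence the minimal primes over \<open>\<I>(V)\<close> are exactly
  the \<open>\<I>(C)\<close>. They have zero loci \<open>\<V>(\<I>(C)) = C\<close>.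
\<close>

subsection \<open>Noetherian subrings and the Hilbert basis theorem\<close>

text \<open>Subrings and their ideals are plain sets in a fixed type, so that rings with different
  carriers can be compared by inclusion.\<close>

definition unital_subring :: "'a::comm_ring_1 set \<Rightarrow> bool" where
  "unital_subring A \<longleftrightarrow> 1 \<in> A \<and> (\<forall>a\<in>A. - a \<in> A) \<and>
     (\<forall>a\<in>A. \<forall>b\<in>A. a + b \<in> A) \<and> (\<forall>a\<in>A. \<forall>b\<in>A. a * b \<in> A)"

text \<open>An ideal of the subring \<open>A\<close>, not of the whole type. Closure under negation
  follows once \<open>-1\<close> lies in \<open>A\<close>.\<close>

definition ideal_of :: "'a::comm_ring_1 set \<Rightarrow> 'a set \<Rightarrow> bool" where
  "ideal_of A J \<longleftrightarrow> J \<subseteq> A \<and> 0 \<in> J \<and> (\<forall>a\<in>J. \<forall>b\<in>J. a + b \<in> J) \<and> (\<forall>a\<in>A. \<forall>b\<in>J. a * b \<in> J)"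

definition noetherian_subring :: "'a::comm_ring_1 set \<Rightarrow> bool" where
  "noetherian_subring A \<longleftrightarrow> unital_subring A \<and>
     (\<forall>J. (\<forall>i. ideal_of A (J i)) \<longrightarrow> incseq J \<longrightarrow> (\<exists>N. \<forall>i\<ge>N. J i = J N))"

lemma unital_subringD:
  assumes "unital_subring A"
  shows "1 \<in> A" "0 \<in> A" "a \<in> A \<Longrightarrow> - a \<in> A" "a \<in> A \<Longrightarrow> b \<in> A \<Longrightarrow> a + b \<in> A"
    "a \<in> A \<Longrightarrow> b \<in> A \<Longrightarrow> a * b \<in> A"
proof -
  show 1: "1 \<in> A" "a \<in> A \<Longrightarrow> - a \<in> A" "a \<in> A \<Longrightarrow> b \<in> A \<Longrightarrow> a + b \<in> A"
    "a \<in> A \<Longrightarrow> b \<in> A \<Longrightarrow> a * b \<in> A" for a b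
    using assms by (auto simp: unital_subring_def)
  show "0 \<in> A" using 1(1) 1(2)[of 1] 1(3)[of 1 "-1"] by simp
qed

lemma ideal_ofD:
  assumes "ideal_of A J"
  shows "J \<subseteq> A" "0 \<in> J" "a \<in> J \<Longrightarrow> b \<in> J \<Longrightarrow> a + b \<in> J" "a \<in> A \<Longrightarrow> b \<in> J \<Longrightarrow> a * b \<in> J"
  using assms by (auto simp: ideal_of_def)

lemma noetherian_subringD:
  assumes "noetherian_subring A"
  shows "unital_subring A"
    "(\<And>i. ideal_of A (J i)) \<Longrightarrow> incseq J \<Longrightarrow> \<exists>N. \<forall>i\<ge>N. J i = J N"
  using assms by (auto simp: noetherian_subring_def)

text \<open>
  Elements of \<open>A[t]\<close> are used through their possibly many representations as polynomials in \<open>t\<close>,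
  so \<open>t\<close> may satisfy relations over \<open>A\<close> (as an inverse variable does) and all variables can be
  adjoined within a single type.
\<close>

primrec polys_below :: "'a::comm_ring_1 set \<Rightarrow> 'a \<Rightarrow> nat \<Rightarrow> 'a set" where
  "polys_below A t 0 = {0}"
| "polys_below A t (Suc d) = {a * t ^ d + q | a q. a \<in> A \<and> q \<in> polys_below A t d}"

definition adjoin :: "'a::comm_ring_1 set \<Rightarrow> 'a \<Rightarrow> 'a set" where
  "adjoin A t = (\<Union>d. polys_below A t d)"

text \<open>The ideals of the classical proof of Hilbert's basis theorem. Every representation of an
  element of \<open>J\<close> with formal degree at most \<open>d\<close> counts, and the
  coefficient \<open>a\<close> may be zero.\<close>

definition leading_coeffs :: "'a::comm_ring_1 set \<Rightarrow> 'a \<Rightarrow> 'a set \<Rightarrow> nat \<Rightarrow> 'a set" where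
  "leading_coeffs A t J d = {a\<in>A. \<exists>q\<in>polys_below A t d. a * t ^ d + q \<in> J}"

context
  fixes A :: "'a::comm_ring_1 set" and t :: 'a
  assumes A: "unital_subring A"
begin

lemma polys_below_SucI:
  "a \<in> A \<Longrightarrow> q \<in> polys_below A t d \<Longrightarrow> a * t ^ d + q \<in> polys_below A t (Suc d)"
  by auto

lemma polys_below_Suc_mono: "p \<in> polys_below A t d \<Longrightarrow> p \<in> polys_below A t (Suc d)"
  using unital_subringD(2)[OF A] by force

lemma polys_below_mono: "d \<le> e \<Longrightarrow> polys_below A t d \<subseteq> polys_below A t e"
  by (rule lift_Suc_mono_le) (use polys_below_Suc_mono in blast)

lemma polys_below_add:
  "p \<in> polys_below A t d \<Longrightarrow> q \<in> polys_below A t d \<Longrightarrow> p + q \<in> polys_below A t d"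
proof (induction d arbitrary: p q)
  case (Suc d)
  then obtain a p' b q' where *: "p = a * t ^ d + p'" "q = b * t ^ d + q'" "a \<in> A" "b \<in> A"
    "p' \<in> polys_below A t d" "q' \<in> polys_below A t d" by auto
  then have "p + q = (a + b) * t ^ d + (p' + q')" by (simp add: algebra_simps)
  then show ?case using polys_below_SucI[OF unital_subringD(4)[OF A] Suc.IH] * by metis
qed simp

lemma polys_below_scale:
  "c \<in> A \<Longrightarrow> p \<in> polys_below A t d \<Longrightarrow> c * p \<in> polys_below A t d"
proof (induction d arbitrary: p)
  case (Suc d)
  then obtain a p' where *: "p = a * t ^ d + p'" "a \<in> A" "p' \<in> polys_below A t d" by auto
  then have "c * p = (c * a) * t ^ d + c * p'" by (simp add: algebra_simps)
  then show ?case
    using polys_below_SucI[OF unital_subringD(5)[OF A] Suc.IH] * Suc.prems(1) by simp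
qed simp

lemma polys_below_shift: "p \<in> polys_below A t d \<Longrightarrow> t * p \<in> polys_below A t (Suc d)"
proof (induction d arbitrary: p)
  case 0
  then show ?case using unital_subringD(2)[OF A] by force
next
  case (Suc d)
  then obtain a p' where *: "p = a * t ^ d + p'" "a \<in> A" "p' \<in> polys_below A t d" by auto
  then have "t * p = a * t ^ Suc d + t * p'" by (simp add: algebra_simps)
  with * Suc.IH[of p'] show ?case unfolding polys_below.simps(2)[of _ _ "Suc d"] by blast
qed

lemma subset_adjoin: "A \<subseteq> adjoin A t"
proof
  fix a assume "a \<in> A"
  then have "a \<in> polys_below A t 1" by auto
  then show "a \<in> adjoin A t" unfolding adjoin_def by blast
qed

lemma adjoin_add: "p \<in> adjoin A t \<Longrightarrow> q \<in> adjoin A t \<Longrightarrow> p + q \<in> adjoin A t"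
  unfolding adjoin_def
proof safe
  fix d e assume "p \<in> polys_below A t d" "q \<in> polys_below A t e"
  then have "p \<in> polys_below A t (max d e)" "q \<in> polys_below A t (max d e)"
    using polys_below_mono[of d "max d e"] polys_below_mono[of e "max d e"] by auto
  then show "p + q \<in> (\<Union>d. polys_below A t d)" using polys_below_add by blast
qed

lemma adjoin_shift: "p \<in> adjoin A t \<Longrightarrow> t ^ k * p \<in> adjoin A t"
proof (induction k)
  case (Suc k)
  then have "t * (t ^ k * p) \<in> adjoin A t"
    using polys_below_shift unfolding adjoin_def by blast
  then show ?case by (simp add: mult.assoc)
qed simp

lemma adjoin_scale: "c \<in> A \<Longrightarrow> p \<in> adjoin A t \<Longrightarrow> c * p \<in> adjoin A t"
  using polys_below_scale unfolding adjoin_def by blast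

lemma generator_in_adjoin: "t \<in> adjoin A t"
  using adjoin_shift[of 1 1] subset_adjoin unital_subringD(1)[OF A] by auto

text \<open>Together with \<open>unital_subring_adjoin\<close> this identifies
  \<open>adjoin A t\<close> as the subring generated by \<open>A\<close> and \<open>t\<close>; it
  keeps extensions inside a prescribed subring \<open>C\<close>.\<close>

lemma adjoin_subset:
  assumes "unital_subring C" "A \<subseteq> C" "t \<in> C"
  shows "adjoin A t \<subseteq> C"
proof -
  have power: "t ^ d \<in> C" for d
    by (induction d) (use assms unital_subringD(1,5) in auto)
  have "polys_below A t d \<subseteq> C" for d
  proof (induction d)
    case 0
    show ?case using unital_subringD(2)[OF assms(1)] by simp
  next
    case (Suc d)
    show ?case
    proof
      fix p assume "p \<in> polys_below A t (Suc d)"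
      then obtain a q where "p = a * t ^ d + q" "a \<in> C" "q \<in> C" using Suc assms(2) by auto
      then show "p \<in> C" using unital_subringD(4,5)[OF assms(1)] power by simp
    qed
  qed
  then show ?thesis unfolding adjoin_def by blast
qed

lemma unital_subring_adjoin: "unital_subring (adjoin A t)"
proof -
  \<comment> \<open>Only the left factor is expanded in powers of \<open>t\<close>; the right one is
    carried along as a member of \<open>adjoin A t\<close>, which is stable under multiplication by
    \<open>A\<close> and by powers of \<open>t\<close>.\<close>
  have mult: "p * q \<in> adjoin A t" if "p \<in> polys_below A t d" "q \<in> adjoin A t" for p q d
    using that
  proof (induction d arbitrary: p)
    case 0
    then show ?case using subset_adjoin unital_subringD(2)[OF A] by auto
  next
    case (Suc d)
    then obtain a p' where *: "p = a * t ^ d + p'" "a \<in> A" "p' \<in> polys_below A t d" by auto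
    then have "p * q = a * (t ^ d * q) + p' * q" by (simp add: algebra_simps)
    with * Suc show ?case using adjoin_add adjoin_scale adjoin_shift by auto
  qed
  have neg: "- p \<in> adjoin A t" if "p \<in> adjoin A t" for p
    using adjoin_scale[of "-1" p] unital_subringD(1,3)[OF A] that by auto
  show ?thesis
    unfolding unital_subring_def
  proof (intro conjI ballI)
    show "1 \<in> adjoin A t" using subset_adjoin unital_subringD(1)[OF A] by blast
    show "p * q \<in> adjoin A t" if "p \<in> adjoin A t" "q \<in> adjoin A t" for p q
    proof -
      from that(1) obtain d where "p \<in> polys_below A t d" unfolding adjoin_def by blast
      then show ?thesis using mult that(2) by blast
    qed
  qed (fact neg, fact adjoin_add)
qed

section \<open>Ideals of leading coefficients and the ascending chain condition\<close>

lemma ideal_of_leading_coeffs: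
  assumes J: "ideal_of (adjoin A t) J"
  shows "ideal_of A (leading_coeffs A t J d)"
  unfolding ideal_of_def
proof (intro conjI ballI)
  have "0 \<in> polys_below A t d" by (induction d) (use unital_subringD(2)[OF A] in force)+
  then show "0 \<in> leading_coeffs A t J d"
    using unital_subringD(2)[OF A] ideal_ofD(2)[OF J] by (force simp: leading_coeffs_def)
next
  fix a b assume "a \<in> leading_coeffs A t J d" "b \<in> leading_coeffs A t J d"
  then obtain p q where *: "a \<in> A" "b \<in> A" "p \<in> polys_below A t d" "q \<in> polys_below A t d"
    "a * t ^ d + p \<in> J" "b * t ^ d + q \<in> J" by (auto simp: leading_coeffs_def)
  then have "(a + b) * t ^ d + (p + q) \<in> J"
    using ideal_ofD(3)[OF J, of "a * t ^ d + p" "b * t ^ d + q"] by (simp add: algebra_simps)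
  with * show "a + b \<in> leading_coeffs A t J d"
    using polys_below_add unital_subringD(4)[OF A] by (auto simp: leading_coeffs_def)
next
  fix a b assume "a \<in> A" "b \<in> leading_coeffs A t J d"
  then obtain q where *: "a \<in> A" "b \<in> A" "q \<in> polys_below A t d" "b * t ^ d + q \<in> J"
    by (auto simp: leading_coeffs_def)
  then have "(a * b) * t ^ d + a * q \<in> J"
    using ideal_ofD(4)[OF J, of a "b * t ^ d + q"] subset_adjoin by (auto simp: algebra_simps)
  with * show "a * b \<in> leading_coeffs A t J d"
    using polys_below_scale unital_subringD(5)[OF A] by (auto simp: leading_coeffs_def)
qed (auto simp: leading_coeffs_def)

text \<open>Multiplication by \<open>t\<close> raises the formal degree by one and keeps the leading
  coefficient, so these ideals also grow with \<open>d\<close>.\<close>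

lemma leading_coeffs_mono:
  assumes "ideal_of (adjoin A t) J'" "J \<subseteq> J'" "d \<le> d'"
  shows "leading_coeffs A t J d \<subseteq> leading_coeffs A t J' d'"
proof -
  have "leading_coeffs A t J' d \<subseteq> leading_coeffs A t J' (Suc d)" for d
  proof
    fix a assume "a \<in> leading_coeffs A t J' d"
    then obtain q where *: "a \<in> A" "q \<in> polys_below A t d" "a * t ^ d + q \<in> J'"
      by (auto simp: leading_coeffs_def)
    then have "a * t ^ Suc d + t * q \<in> J'"
      using ideal_ofD(4)[OF assms(1) generator_in_adjoin, of "a * t ^ d + q"]
      by (simp add: algebra_simps)
    with * polys_below_shift show "a \<in> leading_coeffs A t J' (Suc d)"
      unfolding leading_coeffs_def by blast
  qed
  then have "leading_coeffs A t J' d \<subseteq> leading_coeffs A t J' d'"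
    using \<open>d \<le> d'\<close> by (rule lift_Suc_mono_le)
  then show ?thesis using \<open>J \<subseteq> J'\<close> by (auto simp: leading_coeffs_def)
qed

text \<open>Induction on the degree bound: subtracting from \<open>f\<close> an element of
  \<open>J\<close> with the same leading coefficient leaves a member of \<open>J'\<close> of lower
  formal degree.\<close>

lemma ideal_eq_if_leading_coeffs_eq:
  assumes J: "ideal_of (adjoin A t) J" and J': "ideal_of (adjoin A t) J'" and "J \<subseteq> J'"
    and eq: "\<And>d. leading_coeffs A t J d = leading_coeffs A t J' d"
  shows "J = J'"
proof -
  have neg1: "-1 \<in> adjoin A t"
    using subset_adjoin unital_subringD(1,3)[OF A] by blast
  have "f \<in> J" if "f \<in> J'" "f \<in> polys_below A t d" for f d
    using that
  proof (induction d arbitrary: f)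
    case 0
    then show ?case using ideal_ofD(2)[OF J] by simp
  next
    case (Suc d)
    then obtain a q where f: "f = a * t ^ d + q" "a \<in> A" "q \<in> polys_below A t d" by auto
    then have "a * t ^ d + q \<in> J'" using Suc.prems(1) by simp
    with f have "a \<in> leading_coeffs A t J' d"
      unfolding leading_coeffs_def by blast
    then have "a \<in> leading_coeffs A t J d" by (rule eq[THEN equalityD2, THEN subsetD])
    then obtain p where p: "p \<in> polys_below A t d" "a * t ^ d + p \<in> J"
      by (auto simp: leading_coeffs_def)
    have "f + (-1) * (a * t ^ d + p) \<in> J'"
      using ideal_ofD(3,4)[OF J'] neg1 p(2) \<open>J \<subseteq> J'\<close> Suc.prems(1) by blast
    moreover have "q + (-1) * p \<in> polys_below A t d"
      using f(3) p(1) polys_below_add polys_below_scale unital_subringD(1,3)[OF A] by blast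
    ultimately have "q + (-1) * p \<in> J" using Suc.IH by (simp add: f(1))
    then have "(q + (-1) * p) + (a * t ^ d + p) \<in> J" using ideal_ofD(3)[OF J] p(2) by blast
    then show ?case by (simp add: f(1) algebra_simps)
  qed
  then show ?thesis using \<open>J \<subseteq> J'\<close> ideal_ofD(1)[OF J'] by (auto simp: adjoin_def)
qed

end

text \<open>The ideals of leading coefficients increase in both the chain index and the degree.
  Stability of the diagonal settles all large degrees, the finitely many remaining degrees are
  treated one by one, and equality of all leading coefficients gives equality of the ideals.\<close>

theorem hilbert_basis:
  assumes "noetherian_subring A"
  shows "noetherian_subring (adjoin A t)"
proof -
  note A = noetherian_subringD(1)[OF assms] and acc = noetherian_subringD(2)[OF assms]
  have "\<exists>N. \<forall>i\<ge>N. J i = J N"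
    if J: "\<And>i. ideal_of (adjoin A t) (J i)" and inc: "incseq J" for J
  proof -
    define L where "L k d = leading_coeffs A t (J k) d" for k d
    have L: "ideal_of A (L k d)" for k d
      unfolding L_def by (rule ideal_of_leading_coeffs[OF A J])
    have mono: "L k d \<subseteq> L k' d'" if "k \<le> k'" "d \<le> d'" for k k' d d'
      unfolding L_def using leading_coeffs_mono[OF A J] incseqD[OF inc] that by blast
    obtain D where D: "L i i = L D D" if "i \<ge> D" for i
      using acc[of "\<lambda>i. L i i"] L mono by (auto simp: incseq_def)
    have "\<exists>N. \<forall>i\<ge>N. L i d = L N d" for d
      using acc[of "\<lambda>i. L i d"] L mono by (auto simp: incseq_def)
    then obtain N where N: "\<And>d i. i \<ge> N d \<Longrightarrow> L i d = L (N d) d" by metis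
    \<comment> \<open>\<open>K\<close> lies beyond the stabilisation index \<open>D\<close> of the
      diagonal and beyond those of the finitely many degrees below \<open>D\<close>.\<close>
    define K where "K = Max (insert D (N ` {..<D}))"
    have K: "K \<ge> D" "d < D \<Longrightarrow> K \<ge> N d" for d
      unfolding K_def by (auto intro!: Max_ge)
    have "L K d = L i d" if "i \<ge> K" for i d
    proof (cases "d < D")
      case True
      have "i \<ge> N d" using K(2)[OF True] that by simp
      then show ?thesis using N[of d i] N[of d K] K(2)[OF True] by simp
    next
      case False
      \<comment> \<open>Here \<open>d \<ge> D\<close> and \<open>j \<ge> K \<ge> D\<close>, so
        \<open>L j d\<close> lies between \<open>L D D\<close> and the diagonal ideal at
        \<open>max j d\<close>, which are equal.\<close>
      have "L j d = L D D" if "j \<ge> K" for j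
      proof
        show "L j d \<subseteq> L D D" using mono[of j "max j d" d "max j d"] D[of "max j d"] False by auto
        show "L D D \<subseteq> L j d" using mono K that False by auto
      qed
      then show ?thesis using that by auto
    qed
    then have "J K = J i" if "i \<ge> K" for i
      using ideal_eq_if_leading_coeffs_eq[OF A J J incseqD[OF inc that]] that by (simp add: L_def)
    then show ?thesis by (intro exI[of _ K]) simp
  qed
  then show ?thesis using unital_subring_adjoin[OF A] unfolding noetherian_subring_def by blast
qed

section \<open>Finitely generated rings over a field\<close>

lemma noetherian_subring_field:
  assumes A: "unital_subring A" and inv: "\<And>a. a \<in> A \<Longrightarrow> a \<noteq> 0 \<Longrightarrow> \<exists>b\<in>A. b * a = 1"
  shows "noetherian_subring A"
proof -
  \<comment> \<open>A nonzero ideal contains an invertible element and hence \<open>1\<close>, so an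
    increasing chain changes at most once.\<close>
  have triv: "J = {0} \<or> J = A" if J: "ideal_of A J" for J
  proof (cases "J = {0}")
    case False
    then obtain a where a: "a \<in> J" "a \<noteq> 0" using ideal_ofD(2)[OF J] by auto
    then obtain b where "b \<in> A" "b * a = 1" using inv ideal_ofD(1)[OF J] by blast
    then have "1 \<in> J" using ideal_ofD(4)[OF J] a by metis
    then have "c \<in> J" if "c \<in> A" for c using ideal_ofD(4)[OF J that, of 1] by simp
    then show ?thesis using ideal_ofD(1)[OF J] by blast
  qed simp
  have "\<exists>N. \<forall>i\<ge>N. J i = J N" if "\<And>i. ideal_of A (J i)" "incseq J" for J
  proof (cases "\<exists>N. J N = A")
    case True
    then obtain N where N: "J N = A" by blast
    then have "J i = A" if "i \<ge> N" for i
      using incseqD[OF \<open>incseq J\<close> that] ideal_ofD(1)[OF \<open>ideal_of A (J i)\<close>] by blast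
    with N show ?thesis by auto
  next
    case False
    then have "J i = {0}" for i using triv[OF that(1)] by blast
    then show ?thesis by simp
  qed
  with A show ?thesis by (auto simp: noetherian_subring_def)
qed

text \<open>Repeated use of the basis theorem. The bound \<open>B \<subseteq> C\<close> allows one
  to conclude \<open>B = C\<close> later, once \<open>T\<close> is known to generate
  \<open>C\<close> over \<open>A\<close>.\<close>

lemma noetherian_subring_extend:
  assumes "finite T" "noetherian_subring A" "unital_subring C" "A \<subseteq> C" "T \<subseteq> C"
  shows "\<exists>B. noetherian_subring B \<and> A \<subseteq> B \<and> T \<subseteq> B \<and> B \<subseteq> C"
  using assms(1,5)
proof induction
  case empty
  show ?case using assms(2,4) by (intro exI[of _ A]) simp
next
  case (insert t T)
  then obtain B where B: "noetherian_subring B" "A \<subseteq> B" "T \<subseteq> B" "B \<subseteq> C" by auto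
  note unital = noetherian_subringD(1)[OF B(1)]
  have "A \<subseteq> adjoin B t" "insert t T \<subseteq> adjoin B t"
    using B(2,3) subset_adjoin[OF unital, of t] generator_in_adjoin[OF unital, of t] by auto
  moreover have "adjoin B t \<subseteq> C"
    using adjoin_subset[OF unital assms(3)] B(4) insert.prems by simp
  ultimately show ?case
    using hilbert_basis[OF B(1), of t] by (intro exI[of _ "adjoin B t"] conjI)
qed


subsection \<open>Irreducible components of zero loci\<close>

lemma ring_of_type_algebra_simps [simp]:
  "carrier ring_of_type_algebra = UNIV" "f \<otimes>\<^bsub>ring_of_type_algebra\<^esub> g = f * g"
  "f \<oplus>\<^bsub>ring_of_type_algebra\<^esub> g = f + g" "\<one>\<^bsub>ring_of_type_algebra\<^esub> = 1"
  "\<zero>\<^bsub>ring_of_type_algebra\<^esub> = 0"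
  by (simp_all add: ring_of_type_algebra_def)

text \<open>Bridge from type class rings to the record-based rings for which prime ideals are
  defined.\<close>

lemma cring_unital_subring:
  fixes A :: "'a::comm_ring_1 set"
  assumes "unital_subring A"
  shows "cring (ring_of_type_algebra\<lparr>carrier := A\<rparr>)"
proof -
  interpret T: cring "ring_of_type_algebra :: 'a ring" ..
  have "\<ominus>\<^bsub>ring_of_type_algebra\<^esub> a = - a" for a :: 'a
    by (rule T.minus_equality) simp_all
  then have "subring A ring_of_type_algebra"
    by (intro T.subringI) (use unital_subringD[OF assms] in simp_all)
  then show ?thesis
    using T.subcring_iff[of A] T.subcringI'[of A] by simp
qed

text \<open>\<open>A\<close> is the algebra whose elements define the closed sets, \<open>B\<close>
  a Noetherian ring around it. The laws for \<open>ev\<close> are restricted to \<open>B\<close> and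
  \<open>\<X>\<close> because evaluation of Laurent polynomials is multiplicative only where the
  relevant coordinates are nonzero.\<close>

locale noetherian_evaluation =
  fixes A B :: "'a::comm_ring_1 set" and \<X> :: "'p set" and ev :: "'a \<Rightarrow> 'p \<Rightarrow> 'k::idom"
  assumes subring: "unital_subring A" and noetherian: "noetherian_subring B" and subset: "A \<subseteq> B"
    and ev_add: "f \<in> B \<Longrightarrow> g \<in> B \<Longrightarrow> x \<in> \<X> \<Longrightarrow> ev (f + g) x = ev f x + ev g x"
    and ev_mult: "f \<in> B \<Longrightarrow> g \<in> B \<Longrightarrow> x \<in> \<X> \<Longrightarrow> ev (f * g) x = ev f x * ev g x"
    and ev_one: "x \<in> \<X> \<Longrightarrow> ev 1 x = 1"
begin

abbreviation R where "R \<equiv> ring_of_type_algebra\<lparr>carrier := A\<rparr>"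
abbreviation Z where "Z \<equiv> zero_locus \<X> ev"
abbreviation I where "I \<equiv> vanishing_ideal R ev"
abbreviation closed where "closed \<equiv> superalgebraic R \<X> ev"
abbreviation irreducible where "irreducible \<equiv> irreducible_superalgebraic R \<X> ev"
abbreviation decomposition where
  "decomposition \<equiv> irredundant_irreducible_decomposition R \<X> ev"

lemma ring_simps [simp]:
  "carrier R = A" "f \<otimes>\<^bsub>R\<^esub> g = f * g" "f \<oplus>\<^bsub>R\<^esub> g = f + g" "\<one>\<^bsub>R\<^esub> = 1" "\<zero>\<^bsub>R\<^esub> = 0"
  by simp_all

lemma cring_R: "cring R"
  by (rule cring_unital_subring[OF subring])

text \<open>Lets later arguments use the set-based notion of ideal; negatives come from
  multiplication by \<open>-1\<close>.\<close>

lemma ideal_iff: "ideal P R \<longleftrightarrow> ideal_of A P"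
proof
  assume P: "ideal P R"
  show "ideal_of A P"
    using additive_subgroup.a_subset[OF ideal.axioms(1)[OF P]]
      additive_subgroup.zero_closed[OF ideal.axioms(1)[OF P]]
      additive_subgroup.a_closed[OF ideal.axioms(1)[OF P]] ideal.I_l_closed[OF P]
    unfolding ideal_of_def ring_simps by blast
next
  interpret R: cring R by (rule cring_R)
  assume P: "ideal_of A P"
  have neg: "\<ominus>\<^bsub>R\<^esub> a = - a" if "a \<in> A" for a
    by (rule R.minus_equality) (use that unital_subringD(3)[OF subring] in simp_all)
  show "ideal P R"
  proof (rule idealI[OF R.ring_axioms R.add.subgroupI], unfold ring_simps)
    show "P \<subseteq> A" "P \<noteq> {}" using ideal_ofD(1,2)[OF P] by auto
    show "\<ominus>\<^bsub>R\<^esub> a \<in> P" if "a \<in> P" for a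
      using ideal_ofD(1)[OF P] ideal_ofD(4)[OF P, of "-1" a] unital_subringD(1,3)[OF subring] that
      by (auto simp: neg)
    show "a + b \<in> P" if "a \<in> P" "b \<in> P" for a b using ideal_ofD(3)[OF P] that .
    show "x * a \<in> P" "a * x \<in> P" if "a \<in> P" "x \<in> A" for a x
      using ideal_ofD(4)[OF P that(2,1)] by (simp_all add: mult.commute)
  qed
qed

lemma primeideal_iff:
  "primeideal P R \<longleftrightarrow> ideal_of A P \<and> A \<noteq> P \<and> (\<forall>f\<in>A. \<forall>g\<in>A. f * g \<in> P \<longrightarrow> f \<in> P \<or> g \<in> P)"
  unfolding primeideal_def primeideal_axioms_def ideal_iff ring_simps using cring_R by blast

section \<open>Zero loci and vanishing ideals\<close>

lemma ev_zero: "x \<in> \<X> \<Longrightarrow> ev 0 x = 0"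
  using ev_add[of 0 0 x] unital_subringD(2)[OF subring] subset
  by (metis add.right_neutral add_left_cancel in_mono)

lemma mem_vanishing_ideal: "f \<in> I V \<longleftrightarrow> f \<in> A \<and> (\<forall>x\<in>V. ev f x = 0)"
  by (simp add: vanishing_ideal_def)

lemma vanishing_ideal_antimono: "V \<subseteq> W \<Longrightarrow> I W \<subseteq> I V"
  unfolding vanishing_ideal_def by blast

text \<open>Stated for any subring \<open>C\<close> of \<open>B\<close>, since it is applied both to
  \<open>A\<close> and, for the chain condition, to \<open>B\<close> itself.\<close>

lemma ideal_of_vanishing:
  assumes C: "unital_subring C" "C \<subseteq> B" and V: "V \<subseteq> \<X>"
  shows "ideal_of C {f\<in>C. \<forall>x\<in>V. ev f x = 0}"
proof -
  have "ev (f + g) x = ev f x + ev g x" "ev (f * g) x = ev f x * ev g x"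
    if "f \<in> C" "g \<in> C" "x \<in> V" for f g x
    using that C(2) V by (auto intro!: ev_add ev_mult)
  then show ?thesis
    using V unital_subringD(2,4,5)[OF C(1)] by (auto simp: ideal_of_def ev_zero)
qed

lemma ideal_of_vanishing_ideal: "V \<subseteq> \<X> \<Longrightarrow> ideal_of A (I V)"
  using ideal_of_vanishing[OF subring subset] by (simp add: vanishing_ideal_def)

lemma closed_subset: "closed V \<Longrightarrow> V \<subseteq> \<X>"
  by (auto simp: superalgebraic_def zero_locus_def)

lemma closed_zero_locus: "F \<subseteq> A \<Longrightarrow> closed (Z F)"
  by (auto simp: superalgebraic_def)

lemma zero_locus_vanishing_ideal: "closed V \<Longrightarrow> Z (I V) = V"
  by (auto simp: superalgebraic_def zero_locus_def vanishing_ideal_def)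

lemma closed_subset_iff:
  assumes "closed W" "V \<subseteq> \<X>"
  shows "V \<subseteq> W \<longleftrightarrow> I W \<subseteq> I V"
proof
  assume "I W \<subseteq> I V"
  then have "V \<subseteq> Z (I W)" using assms(2) unfolding zero_locus_def vanishing_ideal_def by blast
  then show "V \<subseteq> W" by (simp add: zero_locus_vanishing_ideal[OF assms(1)])
qed (rule vanishing_ideal_antimono)

lemma closed_Int: "closed V \<Longrightarrow> closed W \<Longrightarrow> closed (V \<inter> W)"
proof -
  assume "closed V" "closed W"
  then obtain F G where "F \<subseteq> A" "G \<subseteq> A" "V = Z F" "W = Z G" by (auto simp: superalgebraic_def)
  then have "V \<inter> W = Z (F \<union> G)" "F \<union> G \<subseteq> A" by (auto simp: zero_locus_def)
  then show ?thesis using closed_zero_locus by simp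
qed

section \<open>Descending chain condition and existence of decompositions\<close>

lemma wf_closed: "wf {(V, W). closed V \<and> closed W \<and> V \<subset> W}"
  unfolding wf_iff_no_infinite_down_chain
proof
  assume "\<exists>V. \<forall>i. (V (Suc i), V i) \<in> {(V, W). closed V \<and> closed W \<and> V \<subset> W}"
  then obtain V where "\<forall>i. (V (Suc i), V i) \<in> {(V, W). closed V \<and> closed W \<and> V \<subset> W}" ..
  then have V: "\<And>i. closed (V i)" "\<And>i. V (Suc i) \<subset> V i" by simp_all
  \<comment> \<open>The vanishing ideals are formed in \<open>B\<close>, where ascending chains of
    ideals stabilise.\<close>
  define J where "J i = {f\<in>B. \<forall>x\<in>V i. ev f x = 0}" for i
  have ideal: "ideal_of B (J i)" for i
    unfolding J_def using noetherian_subringD(1)[OF noetherian] order_refl closed_subset[OF V(1)]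
    by (rule ideal_of_vanishing)
  have incseq: "incseq J"
  proof (rule incseq_SucI)
    show "J i \<subseteq> J (Suc i)" for i using V(2)[of i] unfolding J_def by blast
  qed
  obtain N where "\<forall>i\<ge>N. J i = J N"
    using noetherian_subringD(2)[of B J, OF noetherian ideal incseq] ..
  then have "J (Suc N) = J N" by (rule allE[of _ "Suc N"]) simp
  \<comment> \<open>A closed set is determined by its vanishing ideal in \<open>A\<close>, which is
    the trace of \<open>J i\<close> on \<open>A\<close>; stability of \<open>J\<close> therefore
    contradicts strict descent.\<close>
  moreover have "I (V i) = J i \<inter> A" for i
    using subset unfolding vanishing_ideal_def J_def ring_simps by blast
  ultimately have "I (V (Suc N)) = I (V N)" by simp
  then have "V (Suc N) = V N"
    using zero_locus_vanishing_ideal[OF V(1), of N] zero_locus_vanishing_ideal[OF V(1), of "Suc N"]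
    by simp
  then show False using V(2)[of N] by simp
qed

lemma irreducible_nonempty: "irreducible C \<Longrightarrow> C \<noteq> {}"
  and irreducible_closed: "irreducible C \<Longrightarrow> closed C"
  by (auto simp: irreducible_superalgebraic_def)

text \<open>Well-founded induction: a closed set that is neither empty nor irreducible splits into
  two strictly smaller closed sets. The empty set has the empty cover.\<close>

lemma finite_irreducible_cover:
  assumes "closed V"
  shows "\<exists>\<C>. finite \<C> \<and> (\<forall>C\<in>\<C>. irreducible C) \<and> V = \<Union>\<C>"
  using wf_closed assms
proof (induction V rule: wf_induct_rule)
  case (less V)
  consider "V = {}" | "irreducible V" | "V \<noteq> {}" "\<not> irreducible V" by blast
  then show ?case
  proof cases
    case 3
    with less.prems obtain V1 V2 where *: "closed V1" "closed V2" "V1 \<subset> V" "V2 \<subset> V" "V = V1 \<union> V2"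
      unfolding irreducible_superalgebraic_def by blast
    obtain \<C>1 where "finite \<C>1" "\<forall>C\<in>\<C>1. irreducible C" "V1 = \<Union>\<C>1"
      using less.IH[of V1] * less.prems by blast
    moreover obtain \<C>2 where "finite \<C>2" "\<forall>C\<in>\<C>2. irreducible C" "V2 = \<Union>\<C>2"
      using less.IH[of V2] * less.prems by blast
    ultimately show ?thesis using *(5) by (intro exI[of _ "\<C>1 \<union> \<C>2"]) auto
  qed (auto intro: exI[of _ "{}"] exI[of _ "{V}"])
qed

lemma decomposition_exists:
  assumes "closed V"
  obtains \<C> where "decomposition \<C> V"
proof -
  let ?P = "\<lambda>\<C>. finite \<C> \<and> (\<forall>C\<in>\<C>. irreducible C) \<and> V = \<Union>\<C>"
  obtain \<C>' where "?P \<C>'" using finite_irreducible_cover[OF assms] by auto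
  from ex_has_least_nat[of ?P \<C>' card, OF this]
  obtain \<C> where "?P \<C> \<and> (\<forall>\<D>. ?P \<D> \<longrightarrow> card \<C> \<le> card \<D>)" ..
  then have \<C>: "?P \<C>" and least: "\<forall>\<D>. ?P \<D> \<longrightarrow> card \<C> \<le> card \<D>" by (rule conjunct1, rule conjunct2)
  have "V \<noteq> \<Union>(\<C> - {C})" if "C \<in> \<C>" for C
  proof
    assume "V = \<Union>(\<C> - {C})"
    then have "card \<C> \<le> card (\<C> - {C})" using \<C> by (intro least[rule_format]) auto
    moreover have "card (\<C> - {C}) < card \<C>" using \<C> that by (intro card_Diff1_less) auto
    ultimately show False by simp
  qed
  then show ?thesis
    using \<C> that[of \<C>] unfolding irredundant_irreducible_decomposition_def by blast
qed

section \<open>Prime ideals, uniqueness of decompositions and minimal primes\<close>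

lemma primeideal_vanishing_ideal:
  assumes "irreducible C"
  shows "primeideal (I C) R"
  unfolding primeideal_iff
proof (intro conjI ballI impI)
  have C: "closed C" "C \<subseteq> \<X>" using assms irreducible_closed closed_subset by auto
  then show "ideal_of A (I C)" by (simp add: ideal_of_vanishing_ideal)
  \<comment> \<open>The value of \<open>1\<close> at a point of the nonempty set \<open>C\<close>
    shows that the ideal is proper.\<close>
  have "1 \<notin> I C"
    using irreducible_nonempty[OF assms] C(2) ev_one unfolding vanishing_ideal_def by fastforce
  then show "A \<noteq> I C" using unital_subringD(1)[OF subring] by auto
  fix f g assume f: "f \<in> A" and g: "g \<in> A" and fg: "f * g \<in> I C"
  have "ev (f * g) x = ev f x * ev g x" if "x \<in> C" for x
    using f g subset C(2) that by (intro ev_mult) auto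
  \<comment> \<open>Values lie in an integral domain, so at each point of \<open>C\<close> one
    factor vanishes; irreducibility then makes one of the two closed pieces all of
    \<open>C\<close>.\<close>
  then have "C = (C \<inter> Z {f}) \<union> (C \<inter> Z {g})"
    using fg C(2) by (auto simp: mem_vanishing_ideal zero_locus_def)
  moreover have "closed (C \<inter> Z {f})" "closed (C \<inter> Z {g})"
    using f g C by (auto intro!: closed_Int closed_zero_locus)
  ultimately have "C \<inter> Z {f} = C \<or> C \<inter> Z {g} = C"
    using assms unfolding irreducible_superalgebraic_def by blast
  then show "f \<in> I C \<or> g \<in> I C" using f g by (auto simp: mem_vanishing_ideal zero_locus_def)
qed

text \<open>Since \<open>I\<close> turns unions into intersections, this is the fact that a prime
  containing a finite intersection of ideals contains one of them. With \<open>f \<in> I C\<close>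
  outside \<open>Q\<close>, every \<open>g\<close> vanishing on the other sets satisfies
  \<open>f * g \<in> Q\<close>, hence \<open>g \<in> Q\<close>.\<close>

lemma primeideal_over_Union:
  assumes "finite \<C>" "\<And>C. C \<in> \<C> \<Longrightarrow> C \<subseteq> \<X>" "primeideal Q R" "I (\<Union>\<C>) \<subseteq> Q"
  shows "\<exists>C\<in>\<C>. I C \<subseteq> Q"
  using assms(1,2,4)
proof (induction)
  case empty
  \<comment> \<open>Vanishing on the empty set is no condition, so \<open>Q\<close> would be all of
    \<open>A\<close>, against properness.\<close>
  then have "A \<subseteq> Q" by (simp add: subset_eq mem_vanishing_ideal)
  then show ?case using assms(3) ideal_ofD(1) by (auto simp: primeideal_iff)
next
  case (insert C \<C>)
  show ?case
  proof (cases "I C \<subseteq> Q")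
    case False
    then obtain f where f: "f \<in> I C" "f \<notin> Q" by blast
    have Q: "\<And>f g. f \<in> A \<Longrightarrow> g \<in> A \<Longrightarrow> f * g \<in> Q \<Longrightarrow> f \<in> Q \<or> g \<in> Q"
      using assms(3) by (auto simp: primeideal_iff)
    have "I (\<Union>\<C>) \<subseteq> Q"
    proof
      fix g assume g: "g \<in> I (\<Union>\<C>)"
      have "ev (f * g) x = ev f x * ev g x" if "x \<in> \<Union>(insert C \<C>)" for x
        using f(1) g that subset insert.prems(1) by (intro ev_mult) (auto simp: mem_vanishing_ideal)
      then have "f * g \<in> I (\<Union>(insert C \<C>))"
        using f(1) g unital_subringD(5)[OF subring] by (auto simp: mem_vanishing_ideal)
      then have "f * g \<in> Q" using insert.prems(2) by blast
      then show "g \<in> Q" using Q f g by (auto simp: mem_vanishing_ideal)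
    qed
    then show ?thesis using insert.IH insert.prems(1) by simp
  qed blast
qed

text \<open>The preceding fact about primes is applied to the vanishing ideal of \<open>C\<close>
  and translated back into inclusions of closed sets.\<close>

lemma irreducible_subset_Union:
  assumes "irreducible C" "finite \<D>" "\<And>D. D \<in> \<D> \<Longrightarrow> closed D" "C \<subseteq> \<Union>\<D>"
  shows "\<exists>D\<in>\<D>. C \<subseteq> D"
proof -
  have "\<exists>D\<in>\<D>. I D \<subseteq> I C"
    using assms(2) closed_subset[OF assms(3)] primeideal_vanishing_ideal[OF assms(1)]
      vanishing_ideal_antimono[OF assms(4)] by (rule primeideal_over_Union)
  then obtain D where "D \<in> \<D>" "I D \<subseteq> I C" by blast
  then show ?thesis
    using closed_subset_iff[OF assms(3)] closed_subset[OF irreducible_closed[OF assms(1)]] by blast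
qed

text \<open>Irredundance is used in the form of incomparability: a member contained in a different
  one could be omitted.\<close>

lemma decompositionD:
  assumes "decomposition \<C> V"
  shows "finite \<C>" "C \<in> \<C> \<Longrightarrow> irreducible C" "V = \<Union>\<C>"
    "C \<in> \<C> \<Longrightarrow> C' \<in> \<C> \<Longrightarrow> C \<subseteq> C' \<Longrightarrow> C = C'"
proof -
  show *: "finite \<C>" "C \<in> \<C> \<Longrightarrow> irreducible C" "V = \<Union>\<C>" for C
    using assms by (auto simp: irredundant_irreducible_decomposition_def)
  show "C = C'" if "C \<in> \<C>" "C' \<in> \<C>" "C \<subseteq> C'"
  proof (rule ccontr)
    assume "C \<noteq> C'"
    then have "V = \<Union>(\<C> - {C})" using * that by blast
    then show False using assms that(1) by (auto simp: irredundant_irreducible_decomposition_def)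
  qed
qed

text \<open>Each \<open>C\<close> lies in some \<open>D\<close>, which lies in some
  \<open>C'\<close>; incomparability within \<open>\<C>\<close> forces all three to be equal.
  Exchanging the two decompositions gives uniqueness.\<close>

lemma decomposition_subset:
  assumes "decomposition \<C> V" "decomposition \<D> V"
  shows "\<C> \<subseteq> \<D>"
proof
  fix C assume C: "C \<in> \<C>"
  note \<C> = decompositionD[OF assms(1)] and \<D> = decompositionD[OF assms(2)]
  obtain D where D: "D \<in> \<D>" "C \<subseteq> D"
    using irreducible_subset_Union[OF \<C>(2)[OF C] \<D>(1)] \<D>(2,3) \<C>(3) C irreducible_closed by blast
  moreover obtain C' where "C' \<in> \<C>" "D \<subseteq> C'"
    using irreducible_subset_Union[OF \<D>(2)[OF D(1)] \<C>(1)] \<C>(2,3) \<D>(3) D irreducible_closed by blast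
  ultimately show "C \<in> \<D>" using \<C>(4)[OF C] by (metis subset_antisym subset_trans)
qed

text \<open>Every prime over \<open>I V\<close> contains some \<open>I C\<close>, and the ideals
  \<open>I C\<close> are prime and pairwise incomparable, because \<open>I\<close> reverses and
  reflects inclusions of closed sets.\<close>

lemma minimal_primes_over_vanishing_ideal:
  assumes "decomposition \<C> V"
  shows "minimal_primes_over R (I V) = I ` \<C>"
proof -
  note \<C> = decompositionD[OF assms]
  have prime: "primeideal (I C) R" "I V \<subseteq> I C" if "C \<in> \<C>" for C
    using that \<C>(2,3) primeideal_vanishing_ideal by (auto intro!: vanishing_ideal_antimono)
  have over: "\<exists>C\<in>\<C>. I C \<subseteq> Q" if "primeideal Q R" "I V \<subseteq> Q" for Q
    using primeideal_over_Union[OF \<C>(1) _ that(1)] that(2) \<C>(2,3) closed_subset irreducible_closed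
    by simp
  have incomparable: "C = C'" if "C \<in> \<C>" "C' \<in> \<C>" "I C \<subseteq> I C'" for C C'
  proof -
    have "closed C" "C' \<subseteq> \<X>"
      using \<C>(2) that irreducible_closed closed_subset by auto
    then have "C' \<subseteq> C" using closed_subset_iff that(3) by simp
    then show ?thesis using \<C>(4) that by blast
  qed
  show ?thesis
  proof
    show "minimal_primes_over R (I V) \<subseteq> I ` \<C>"
    proof
      fix P assume P: "P \<in> minimal_primes_over R (I V)"
      then obtain C where "C \<in> \<C>" "I C \<subseteq> P"
        using over unfolding minimal_primes_over_def by blast
      then show "P \<in> I ` \<C>" using P prime unfolding minimal_primes_over_def by blast
    qed
    show "I ` \<C> \<subseteq> minimal_primes_over R (I V)"
    proof
      fix P assume "P \<in> I ` \<C>"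
      then obtain C where C: "C \<in> \<C>" "P = I C" by blast
      have False if Q: "primeideal Q R" "I V \<subseteq> Q" "Q \<subset> P" for Q
      proof -
        obtain C' where "C' \<in> \<C>" "I C' \<subseteq> Q" using over Q by blast
        then show False using incomparable C Q(3) by blast
      qed
      then show "P \<in> minimal_primes_over R (I V)"
        using prime C unfolding minimal_primes_over_def by blast
    qed
  qed
qed

text \<open>Injectivity of \<open>Z\<close> on \<open>M\<close> makes the components of distinct
  minimal primes distinct. The final equivalence contains both that the components form an
  irredundant decomposition and that it is the only one.\<close>

theorem minimal_primes_decomposition:
  assumes "closed V" "J = I V" "M = minimal_primes_over R J"
  shows "finite M \<and> (\<forall>P\<in>M. irreducible (Z P)) \<and> V = (\<Union>P\<in>M. Z P) \<and> inj_on Z M \<and>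
    (\<forall>\<C>. decomposition \<C> V \<longleftrightarrow> \<C> = Z ` M)"
proof (intro conjI)
  obtain \<C> where dec: "decomposition \<C> V" using decomposition_exists assms(1) .
  note \<C> = decompositionD[OF dec]
  have ZI: "Z (I C) = C" if "C \<in> \<C>" for C
    using \<C>(2)[OF that] zero_locus_vanishing_ideal irreducible_closed by blast
  have M: "M = I ` \<C>" using minimal_primes_over_vanishing_ideal[OF dec] assms(2,3) by simp
  then have ZM: "Z ` M = \<C>" using ZI by (auto simp: image_iff)
  show "finite M" using M \<C>(1) by simp
  show "\<forall>P\<in>M. irreducible (Z P)" "V = (\<Union>P\<in>M. Z P)" using ZM \<C>(2,3) by auto
  show "inj_on Z M" unfolding M using ZI by (auto simp: inj_on_def)
  show "\<forall>\<C>. decomposition \<C> V \<longleftrightarrow> \<C> = Z ` M"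
    using decomposition_subset dec ZM by blast
qed

end


subsection \<open>Polynomials and Laurent polynomials\<close>

text \<open>Any \<open>f\<close> is the sum of its monomials. Only monomials from the support of
  \<open>f\<close> are asked for, so that conditions on its exponents, such as
  \<open>in_vars\<close>, stay available.\<close>

lemma poly_mapping_monomial_induct [case_names zero monomial add]:
  fixes f :: "'a \<Rightarrow>\<^sub>0 'b::comm_monoid_add"
  assumes "P 0" "\<And>a. a \<in> Poly_Mapping.keys f \<Longrightarrow> P (Poly_Mapping.single a (Poly_Mapping.lookup f a))"
    "\<And>g h. P g \<Longrightarrow> P h \<Longrightarrow> P (g + h)"
  shows "P f"
proof -
  have "f = (\<Sum>a\<in>Poly_Mapping.keys f. Poly_Mapping.single a (Poly_Mapping.lookup f a))"
    by (rule poly_mapping_eqI)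
      (auto simp: lookup_sum lookup_single when_def sum.delta in_keys_iff)
  moreover have "P (\<Sum>a\<in>S. Poly_Mapping.single a (Poly_Mapping.lookup f a))"
    if "finite S" "S \<subseteq> Poly_Mapping.keys f" for S
    using that by (induction S rule: finite_induct) (use assms in auto)
  ultimately show ?thesis by (metis finite_keys order_refl)
qed

text \<open>Reduces multiplicativity and product rules to monomials. The exponents range over the
  two supports because multiplicativity of \<open>eval_L\<close> depends on the variables that
  occur.\<close>

lemma biadditive_eqI:
  fixes G H :: "('a \<Rightarrow>\<^sub>0 'b::comm_monoid_add) \<Rightarrow> ('c \<Rightarrow>\<^sub>0 'd::comm_monoid_add) \<Rightarrow> 'e::ab_group_add"
  assumes G: "\<And>f f' g. G (f + f') g = G f g + G f' g" "\<And>f g g'. G f (g + g') = G f g + G f g'"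
    and H: "\<And>f f' g. H (f + f') g = H f g + H f' g" "\<And>f g g'. H f (g + g') = H f g + H f g'"
    and eq: "\<And>a b x y. a \<in> Poly_Mapping.keys f \<Longrightarrow> b \<in> Poly_Mapping.keys g \<Longrightarrow>
      G (Poly_Mapping.single a x) (Poly_Mapping.single b y) =
      H (Poly_Mapping.single a x) (Poly_Mapping.single b y)"
  shows "G f g = H f g"
proof -
  have zero: "G 0 g = 0" "G f 0 = 0" "H 0 g = 0" "H f 0 = 0" for f g
    using G(1)[of 0 0] G(2)[of _ 0 0] H(1)[of 0 0] H(2)[of _ 0 0] by simp_all
  have monomial: "G (Poly_Mapping.single a x) g = H (Poly_Mapping.single a x) g"
    if "a \<in> Poly_Mapping.keys f" for a x
    by (induction g rule: poly_mapping_monomial_induct) (simp_all add: zero eq that G H)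
  show ?thesis
    by (induction f rule: poly_mapping_monomial_induct) (simp_all add: zero monomial G H)
qed

lemma keys_uminus_eq: "Poly_Mapping.keys (- f) = Poly_Mapping.keys (f :: 'a \<Rightarrow>\<^sub>0 'b::ab_group_add)"
  by (auto simp: in_keys_iff)

text \<open>Common form of \<open>substitute\<close> and \<open>eval_L\<close>: \<open>h\<close>
  acts on coefficients and \<open>\<phi>\<close> gives the value of a monomial.\<close>

definition monomial_sum ::
  "('k::zero \<Rightarrow> 'r::comm_semiring_1) \<Rightarrow> ('a \<Rightarrow> 'r) \<Rightarrow> ('a \<Rightarrow>\<^sub>0 'k) \<Rightarrow> 'r" where
  "monomial_sum h \<phi> f = (\<Sum>e\<in>Poly_Mapping.keys f. h (Poly_Mapping.lookup f e) * \<phi> e)"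

lemma monomial_sum_superset:
  assumes "finite S" "Poly_Mapping.keys f \<subseteq> S" "h 0 = 0"
  shows "monomial_sum h \<phi> f = (\<Sum>e\<in>S. h (Poly_Mapping.lookup f e) * \<phi> e)"
  unfolding monomial_sum_def
  by (rule sum.mono_neutral_left) (use assms in \<open>auto simp: in_keys_iff\<close>)

lemma monomial_sum_add:
  fixes f g :: "'a \<Rightarrow>\<^sub>0 'k::comm_monoid_add"
  assumes h: "h 0 = 0" "\<And>x y. h (x + y) = h x + h y"
  shows "monomial_sum h \<phi> (f + g) = monomial_sum h \<phi> f + monomial_sum h \<phi> g"
proof -
  let ?S = "Poly_Mapping.keys f \<union> Poly_Mapping.keys g"
  have "monomial_sum h \<phi> p = (\<Sum>e\<in>?S. h (Poly_Mapping.lookup p e) * \<phi> e)"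
    if "Poly_Mapping.keys p \<subseteq> ?S" for p
    using that by (intro monomial_sum_superset) (simp_all add: h)
  then show ?thesis
    using keys_add[of f g] by (simp add: lookup_add h(2) sum.distrib distrib_right)
qed

lemma monomial_sum_single: "h 0 = 0 \<Longrightarrow> monomial_sum h \<phi> (Poly_Mapping.single e c) = h c * \<phi> e"
  by (simp add: monomial_sum_def)

lemma monomial_sum_mult:
  fixes f g :: "'a::comm_monoid_add \<Rightarrow>\<^sub>0 'k::comm_ring_1" and h :: "'k \<Rightarrow> 'r::comm_ring_1"
  assumes h: "h 0 = 0" "\<And>x y. h (x + y) = h x + h y" "\<And>x y. h (x * y) = h x * h y"
    and \<phi>: "\<And>a b. a \<in> Poly_Mapping.keys f \<Longrightarrow> b \<in> Poly_Mapping.keys g \<Longrightarrow> \<phi> (a + b) = \<phi> a * \<phi> b"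
  shows "monomial_sum h \<phi> (f * g) = monomial_sum h \<phi> f * monomial_sum h \<phi> g"
  by (rule biadditive_eqI)
    (simp_all add: monomial_sum_add monomial_sum_single mult_single h \<phi> algebra_simps)

text \<open>\<open>s v\<close> stands for exponentiation of the value at \<open>v\<close>, with
  natural or integer exponents. Products are compared over the union of both supports because
  exponents can cancel in \<open>a + b\<close>.\<close>

lemma prod_keys_add:
  fixes a b :: "'v \<Rightarrow>\<^sub>0 'e::comm_monoid_add" and s :: "'v \<Rightarrow> 'e \<Rightarrow> 'r::comm_monoid_mult"
  assumes "\<And>v. v \<in> Poly_Mapping.keys a \<union> Poly_Mapping.keys b \<Longrightarrow> s v 0 = 1"
    and "\<And>v x y. v \<in> Poly_Mapping.keys a \<union> Poly_Mapping.keys b \<Longrightarrow> s v (x + y) = s v x * s v y"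
  shows "(\<Prod>v\<in>Poly_Mapping.keys (a + b). s v (Poly_Mapping.lookup (a + b) v)) =
    (\<Prod>v\<in>Poly_Mapping.keys a. s v (Poly_Mapping.lookup a v)) *
    (\<Prod>v\<in>Poly_Mapping.keys b. s v (Poly_Mapping.lookup b v))"
proof -
  let ?S = "Poly_Mapping.keys a \<union> Poly_Mapping.keys b"
  have "(\<Prod>v\<in>Poly_Mapping.keys p. s v (Poly_Mapping.lookup p v)) =
      (\<Prod>v\<in>?S. s v (Poly_Mapping.lookup p v))" if "Poly_Mapping.keys p \<subseteq> ?S" for p
    by (rule prod.mono_neutral_left) (use that assms(1) in \<open>auto simp: in_keys_iff\<close>)
  from this[OF keys_add] this[of a] this[of b] show ?thesis
    by (simp add: lookup_add assms(2) prod.distrib)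
qed

section \<open>Substitution and evaluation as ring homomorphisms\<close>

lemma substitute_eq_monomial_sum:
  "substitute h s = monomial_sum h (\<lambda>e. \<Prod>v\<in>Poly_Mapping.keys e. s v ^ Poly_Mapping.lookup e v)"
  by (simp add: fun_eq_iff substitute_def monomial_sum_def)

context
  fixes h :: "'k::comm_ring_1 \<Rightarrow> 'r::comm_ring_1"
  assumes h: "h 0 = 0" "\<And>x y. h (x + y) = h x + h y" "\<And>x y. h (x * y) = h x * h y"
begin

lemma substitute_add: "substitute h s (f + g) = substitute h s f + substitute h s g"
  unfolding substitute_eq_monomial_sum by (rule monomial_sum_add) (simp_all add: h)

lemma substitute_mult: "substitute h s (f * g) = substitute h s f * substitute h s g"
  unfolding substitute_eq_monomial_sum
  by (intro monomial_sum_mult prod_keys_add) (simp_all add: h power_add)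

end

lemma substitute_one: "h 1 = 1 \<Longrightarrow> substitute h s 1 = (1 :: 'r::comm_semiring_1)"
  by (simp add: substitute_def)

lemma const_simps:
  "const 0 = 0" "const (x + y) = const x + const y" "const (x * y) = const x * const y"
  "const 1 = 1" "const (- z) = - const z"
  for x y :: "'k::comm_semiring_1" and z :: "'l::comm_ring_1"
  by (simp_all add: const_def single_add mult_single single_uminus)

lemma super_specialize_hom:
  "super_specialize (f + g) = super_specialize f + super_specialize g"
  "super_specialize (f * g) = super_specialize f * super_specialize g"
  "super_specialize 1 = 1"
  unfolding super_specialize_def
  by (rule substitute_add substitute_mult substitute_one; simp add: const_simps one_pCons)+

lemma eval_S_hom:
  "eval_S (f + g) x = eval_S f x + eval_S g x"
  "eval_S (f * g) x = eval_S f x * eval_S g x"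
  "eval_S 1 x = 1"
  unfolding eval_S_def by (rule substitute_add substitute_mult substitute_one; simp)+

lemma eval_L_eq_monomial_sum:
  "eval_L f x = monomial_sum (\<lambda>c. c)
     (\<lambda>e. \<Prod>v\<in>Poly_Mapping.keys e. case_sum (fst x) (snd x) v powi Poly_Mapping.lookup e v) f"
  by (simp add: eval_L_def monomial_sum_def)

lemma space_L_nonzero:
  assumes "x \<in> space_L m n" "v \<in> vars m n"
  shows "case_sum (fst x) (snd x) v \<noteq> 0"
  using assms by (fastforce simp: space_L_def vars_def)

text \<open>Multiplicativity relies on nonzero coordinates: \<open>0 powi (1 + -1)\<close> is 1,
  whereas the product of the two separate powers is 0.\<close>

lemma eval_L_hom:
  "eval_L (f + g) x = eval_L f x + eval_L g x"
  "x \<in> space_L m n \<Longrightarrow> in_vars m n f \<Longrightarrow> in_vars m n g \<Longrightarrow> eval_L (f * g) x = eval_L f x * eval_L g x"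
  "eval_L 1 x = 1"
proof -
  show "eval_L (f + g) x = eval_L f x + eval_L g x"
    unfolding eval_L_eq_monomial_sum by (rule monomial_sum_add) simp_all
  show "eval_L (f * g) x = eval_L f x * eval_L g x"
    if "x \<in> space_L m n" "in_vars m n f" "in_vars m n g"
    unfolding eval_L_eq_monomial_sum
  proof (rule monomial_sum_mult)
    fix a b assume "a \<in> Poly_Mapping.keys f" "b \<in> Poly_Mapping.keys g"
    then have "Poly_Mapping.keys a \<union> Poly_Mapping.keys b \<subseteq> vars m n"
      using that(2,3) by (simp add: in_vars_def)
    then have "case_sum (fst x) (snd x) v \<noteq> 0"
      if "v \<in> Poly_Mapping.keys a \<union> Poly_Mapping.keys b" for v
      using that by (intro space_L_nonzero[OF \<open>x \<in> space_L m n\<close>]) blast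
    then show "(\<Prod>v\<in>Poly_Mapping.keys (a + b).
        case_sum (fst x) (snd x) v powi Poly_Mapping.lookup (a + b) v) =
      (\<Prod>v\<in>Poly_Mapping.keys a. case_sum (fst x) (snd x) v powi Poly_Mapping.lookup a v) *
      (\<Prod>v\<in>Poly_Mapping.keys b. case_sum (fst x) (snd x) v powi Poly_Mapping.lookup b v)"
      by (intro prod_keys_add) (simp_all add: power_int_add)
  qed simp_all
  show "eval_L 1 x = 1" by (simp add: eval_L_def)
qed

section \<open>The algebras of both cases are subrings\<close>

lemma unital_subring_in_vars:
  "unital_subring {f :: (var \<Rightarrow>\<^sub>0 'e::comm_monoid_add) \<Rightarrow>\<^sub>0 'k::comm_ring_1. in_vars m n f}"
  unfolding unital_subring_def
proof (intro conjI ballI; unfold mem_Collect_eq)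
  fix f g :: "(var \<Rightarrow>\<^sub>0 'e) \<Rightarrow>\<^sub>0 'k" assume fg: "in_vars m n f" "in_vars m n g"
  show "in_vars m n (- f)" using fg by (simp add: in_vars_def keys_uminus_eq)
  show "in_vars m n (f + g)" using fg keys_add[of f g] by (auto simp: in_vars_def)
  show "in_vars m n (f * g)"
    unfolding in_vars_def
  proof
    fix e assume "e \<in> Poly_Mapping.keys (f * g)"
    then obtain a b where "e = a + b" "a \<in> Poly_Mapping.keys f" "b \<in> Poly_Mapping.keys g"
      using keys_mult[of f g] by blast
    then show "Poly_Mapping.keys e \<subseteq> vars m n"
      using keys_add[of a b] fg unfolding in_vars_def by blast
  qed
qed (simp add: in_vars_def)

text \<open>On a monomial \<open>permute_vars \<pi>\<close> acts through the inverse permutation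
  \<open>\<rho>\<close>, additively in the exponents; products then follow by biadditivity.\<close>

lemma permute_vars_hom:
  fixes f g :: "(var \<Rightarrow>\<^sub>0 'e::comm_monoid_add) \<Rightarrow>\<^sub>0 'k::comm_ring_1"
  assumes "bij \<pi>"
  shows "permute_vars \<pi> (f + g) = permute_vars \<pi> f + permute_vars \<pi> g"
    "permute_vars \<pi> (f * g) = permute_vars \<pi> f * permute_vars \<pi> g"
    "permute_vars \<pi> (1 :: (var \<Rightarrow>\<^sub>0 'e) \<Rightarrow>\<^sub>0 'k) = 1"
proof -
  let ?m = "Poly_Mapping.map_key \<pi> :: (var \<Rightarrow>\<^sub>0 'e) \<Rightarrow> _"
  define \<rho> where "\<rho> = inv_into UNIV \<pi>"
  have inj: "inj \<pi>" "inj \<rho>" and inverse: "\<rho> \<circ> \<pi> = id" "\<pi> \<circ> \<rho> = id"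
    using assms bij_imp_bij_inv[OF assms] unfolding \<rho>_def
    by (simp_all add: bij_is_inj bij_is_surj surj_iff[symmetric])
  have right_inverse: "?m (Poly_Mapping.map_key \<rho> e) = e" for e :: "var \<Rightarrow>\<^sub>0 'e"
    by (simp add: map_key_compose inj inverse map_key_id[folded id_def])
  have left_inverse: "Poly_Mapping.map_key \<rho> (?m e) = e" for e :: "var \<Rightarrow>\<^sub>0 'e"
    by (simp add: map_key_compose inj inverse map_key_id[folded id_def])
  have m: "inj ?m" by (rule inj_on_inverseI[of _ "Poly_Mapping.map_key \<rho>"]) (rule left_inverse)
  have single: "permute_vars \<pi> (Poly_Mapping.single e c) =
      Poly_Mapping.single (Poly_Mapping.map_key \<rho> e) c" for e :: "var \<Rightarrow>\<^sub>0 'e" and c :: 'k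
    using map_key_single[OF m, of "Poly_Mapping.map_key \<rho> e" c]
    by (simp add: permute_vars_def right_inverse)
  show add: "permute_vars \<pi> (f + g) = permute_vars \<pi> f + permute_vars \<pi> g"
    for f g :: "(var \<Rightarrow>\<^sub>0 'e) \<Rightarrow>\<^sub>0 'k"
    by (simp add: permute_vars_def map_key_plus m)
  show "permute_vars \<pi> (f * g) = permute_vars \<pi> f * permute_vars \<pi> g"
    by (rule biadditive_eqI)
      (simp_all add: add single mult_single map_key_plus inj algebra_simps)
  show "permute_vars \<pi> (1 :: (var \<Rightarrow>\<^sub>0 'e) \<Rightarrow>\<^sub>0 'k) = 1"
    using single[of 0 1] by (simp add: inj)
qed

lemma bij_map_sum:
  assumes "bij f" "bij g"
  shows "bij (map_sum f g)"
proof (rule o_bij)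
  let ?h = "map_sum (inv_into UNIV f) (inv_into UNIV g)"
  show "?h \<circ> map_sum f g = id" "map_sum f g \<circ> ?h = id"
    using assms by (simp_all add: map_sum.comp map_sum.id bij_is_inj bij_is_surj
      surj_iff[THEN iffD1])
qed

lemma unital_subring_doubly_symmetric:
  "unital_subring {f :: (var \<Rightarrow>\<^sub>0 'e::comm_monoid_add) \<Rightarrow>\<^sub>0 'k::comm_ring_1. doubly_symmetric m n f}"
proof -
  have bij: "bij (map_sum \<sigma> \<tau>)" if "\<sigma> permutes {..<m}" "\<tau> permutes {..<n}" for \<sigma> \<tau>
    using that by (intro bij_map_sum permutes_bij)
  have "permute_vars \<pi> (- f) = - f" if "bij \<pi>" "permute_vars \<pi> f = f"
    for \<pi> and f :: "(var \<Rightarrow>\<^sub>0 'e) \<Rightarrow>\<^sub>0 'k"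
  proof -
    have "permute_vars \<pi> 0 = (0 :: (var \<Rightarrow>\<^sub>0 'e) \<Rightarrow>\<^sub>0 'k)"
      using permute_vars_hom(1)[OF that(1), of 0 0] by simp
    then show ?thesis
      using permute_vars_hom(1)[OF that(1), of "- f" f] that(2) by (simp add: eq_neg_iff_add_eq_0)
  qed
  then show ?thesis
    by (simp add: unital_subring_def doubly_symmetric_def permute_vars_hom bij)
qed

text \<open>Specialisation is a ring homomorphism into polynomials in \<open>t\<close>, and those of
  degree 0, the zero polynomial included by convention, form a subring.\<close>

lemma unital_subring_algebra_S:
  "unital_subring (carrier (algebra_S m n :: 'k::comm_ring_1 mpoly ring))"
proof -
  note vars = unital_subring_in_vars[where ?'e = nat and ?'k = 'k, of m n, unfolded unital_subring_def]
    and sym = unital_subring_doubly_symmetric[where ?'e = nat and ?'k = 'k, of m n, unfolded unital_subring_def]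
  have "super_specialize (0 :: 'k mpoly) = 0"
    using super_specialize_hom(1)[of 0 "0 :: 'k mpoly"] by simp
  then have "super_specialize (- f) = - super_specialize f" for f :: "'k mpoly"
    using super_specialize_hom(1)[of "- f" f] by (simp add: eq_neg_iff_add_eq_0)
  moreover have "Polynomial.degree (p + q) = 0" "Polynomial.degree (p * q) = 0"
    if "Polynomial.degree p = 0" "Polynomial.degree q = 0" for p q :: "'k mpoly poly"
    using degree_add_le[of p 0 q] degree_mult_le[of p q] that by simp_all
  ultimately show ?thesis
    using vars sym by (auto simp: algebra_S_def unital_subring_def super_specialize_hom)
qed

text \<open>
  Unlike \<open>partial_deriv\<close>, the Euler operator acts diagonally on monomials.
\<close>

definition euler :: "var \<Rightarrow> ('k::comm_ring_1) laurent \<Rightarrow> 'k laurent" where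
  "euler v f = var v * partial_deriv v f"

text \<open>The factor \<open>var v\<close> undoes the exponent shift in
  \<open>partial_deriv\<close>, leaving multiplication by the exponent of \<open>v\<close>.\<close>

lemma lookup_euler:
  "Poly_Mapping.lookup (euler v f) e = of_int (Poly_Mapping.lookup e v) * Poly_Mapping.lookup f e"
proof -
  have "euler v f = (\<Sum>e\<in>Poly_Mapping.keys f.
      Poly_Mapping.single e (of_int (Poly_Mapping.lookup e v) * Poly_Mapping.lookup f e))"
    by (simp add: euler_def partial_deriv_def var_def sum_distrib_left mult_single)
  then show ?thesis
    by (auto simp: lookup_sum lookup_single when_def sum.delta in_keys_iff)
qed

lemma euler_add: "euler v (f + g) = euler v f + euler v g"
  by (rule poly_mapping_eqI) (simp add: lookup_euler lookup_add algebra_simps)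

lemma euler_uminus: "euler v (- f) = - euler v f"
  by (rule poly_mapping_eqI) (simp add: lookup_euler)

lemma euler_one: "euler v 1 = 0"
  by (rule poly_mapping_eqI) (simp add: lookup_euler lookup_one when_def)

lemma euler_single:
  "euler v (Poly_Mapping.single e c) = Poly_Mapping.single e (of_int (Poly_Mapping.lookup e v) * c)"
  by (rule poly_mapping_eqI) (simp add: lookup_euler lookup_single when_def)

lemma euler_mult: "euler v (f * g) = euler v f * g + f * euler v g"
  by (rule biadditive_eqI)
    (simp_all add: euler_add euler_single mult_single lookup_add single_add[symmetric] algebra_simps)

text \<open>\<open>D i j\<close> is a derivation and \<open>J i j\<close> an ideal, so the product
  rule puts \<open>D i j (f * g)\<close> into \<open>J i j\<close> whenever \<open>D i j f\<close>
  and \<open>D i j g\<close> are there.\<close>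

lemma unital_subring_algebra_L:
  "unital_subring (carrier (algebra_L m n :: 'k::comm_ring_1 laurent ring))"
proof -
  note vars = unital_subring_in_vars[where ?'e = int and ?'k = 'k, of m n]
    and sym = unital_subring_doubly_symmetric[where ?'e = int and ?'k = 'k, of m n, unfolded unital_subring_def]
  define D where "D i j f = euler (Inl i) f + euler (Inr j) f" for i j and f :: "'k laurent"
  have D: "D i j (f + g) = D i j f + D i j g" "D i j (f * g) = g * D i j f + f * D i j g"
    "D i j (- f) = - D i j f" "D i j 1 = 0" for i j f g
    by (simp_all add: D_def euler_add euler_mult euler_uminus euler_one algebra_simps)
  define J where "J i j = PIdl\<^bsub>laurent_ring m n\<^esub> (var (Inl i) - var (Inr j) :: 'k laurent)" for i j
  \<comment> \<open>The principal ideal is taken in \<open>laurent_ring m n\<close>, so the cofactor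
    \<open>q\<close> must itself involve only admissible variables.\<close>
  have J: "p \<in> J i j \<longleftrightarrow> (\<exists>q. in_vars m n q \<and> p = q * (var (Inl i) - var (Inr j)))" for p i j
    by (auto simp: J_def cgenideal_def laurent_ring_def)
  note in_vars = unital_subringD(2-5)[OF vars, unfolded mem_Collect_eq]
  have J_closed: "0 \<in> J i j" "p \<in> J i j \<Longrightarrow> q \<in> J i j \<Longrightarrow> p + q \<in> J i j" "p \<in> J i j \<Longrightarrow> - p \<in> J i j"
    "in_vars m n f \<Longrightarrow> p \<in> J i j \<Longrightarrow> f * p \<in> J i j" for p q f i j
  proof -
    show "0 \<in> J i j" unfolding J using in_vars(1) by (intro exI[of _ 0]) simp
    show "p + q \<in> J i j" if "p \<in> J i j" "q \<in> J i j"
      using that in_vars(3) unfolding J by (metis distrib_right)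
    show "- p \<in> J i j" if "p \<in> J i j"
      using that in_vars(2) unfolding J by (metis mult_minus_left)
    show "f * p \<in> J i j" if "in_vars m n f" "p \<in> J i j"
    proof -
      from that(2) obtain q where "in_vars m n q" "p = q * (var (Inl i) - var (Inr j))"
        unfolding J by blast
      then show ?thesis
        using in_vars(4)[OF that(1)] unfolding J by (intro exI[of _ "f * q"]) (simp add: mult.assoc)
    qed
  qed
  have "carrier (algebra_L m n) = {f. in_vars m n f \<and> doubly_symmetric m n f \<and>
      (\<forall>i<m. \<forall>j<n. D i j f \<in> J i j)}"
    by (simp add: algebra_L_def D_def J_def euler_def)
  then show ?thesis
    using vars sym J_closed by (auto simp: unital_subring_def D)
qed

section \<open>The ambient rings are Noetherian\<close>

lemma noetherian_subring_const:
  "noetherian_subring (range const :: ((var \<Rightarrow>\<^sub>0 'e::comm_monoid_add) \<Rightarrow>\<^sub>0 'k::field) set)"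
proof (rule noetherian_subring_field)
  show "unital_subring (range const :: ((var \<Rightarrow>\<^sub>0 'e) \<Rightarrow>\<^sub>0 'k) set)"
    unfolding unital_subring_def by (auto simp: const_simps[symmetric])
  fix a :: "(var \<Rightarrow>\<^sub>0 'e) \<Rightarrow>\<^sub>0 'k" assume "a \<in> range const" "a \<noteq> 0"
  then obtain c where "a = const c" "c \<noteq> 0" by (metis const_simps(1) imageE)
  then show "\<exists>b\<in>range const. b * a = 1"
    by (intro bexI[of _ "const (inverse c)"]) (simp_all add: const_simps(3,4)[symmetric])
qed

text \<open>One statement for natural and integer exponents: by \<open>powers\<close>, the set
  \<open>T\<close> generates every power of a single admissible variable. Constants and
  \<open>T\<close> then generate all monomials, hence the whole ring.\<close>

lemma noetherian_subring_in_vars: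
  fixes T :: "((var \<Rightarrow>\<^sub>0 'e::comm_monoid_add) \<Rightarrow>\<^sub>0 'k::field) set"
  assumes T: "finite T" "\<And>t. t \<in> T \<Longrightarrow> in_vars m n t"
    and powers: "\<And>B v k. unital_subring B \<Longrightarrow> T \<subseteq> B \<Longrightarrow> v \<in> vars m n \<Longrightarrow>
      Poly_Mapping.single (Poly_Mapping.single v k) 1 \<in> B"
  shows "noetherian_subring {f :: (var \<Rightarrow>\<^sub>0 'e) \<Rightarrow>\<^sub>0 'k. in_vars m n f}"
proof -
  let ?C = "{f :: (var \<Rightarrow>\<^sub>0 'e) \<Rightarrow>\<^sub>0 'k. in_vars m n f}"
  have "range const \<subseteq> ?C" by (auto simp: in_vars_def const_def split: if_splits)
  then obtain B where B: "noetherian_subring B" "range const \<subseteq> B" "T \<subseteq> B" "B \<subseteq> ?C"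
    using noetherian_subring_extend[OF T(1) noetherian_subring_const unital_subring_in_vars] T(2)
    by blast
  note unital = noetherian_subringD(1)[OF B(1)]
  \<comment> \<open>The exponent is built up from exponents of single variables; adding exponents
    means multiplying monomials.\<close>
  have single: "Poly_Mapping.single e 1 \<in> B" if "Poly_Mapping.keys e \<subseteq> vars m n" for e
  proof (induction e rule: poly_mapping_monomial_induct)
    case zero
    then show ?case using unital_subringD(1)[OF unital] by simp
  next
    case (monomial v)
    then show ?case using powers[OF unital B(3)] that by blast
  next
    case (add a b)
    then show ?case using unital_subringD(5)[OF unital add] by (simp add: mult_single)
  qed
  have "f \<in> B" if "in_vars m n f" for f
  proof (induction f rule: poly_mapping_monomial_induct)
    case zero
    then show ?case using unital_subringD(2)[OF unital] .
  next
    case (monomial e)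
    then have "const (Poly_Mapping.lookup f e) * Poly_Mapping.single e 1 \<in> B"
      using that B(2) by (intro unital_subringD(5)[OF unital] single) (auto simp: in_vars_def)
    then show ?case by (simp add: const_def mult_single)
  next
    case (add a b)
    then show ?case using unital_subringD(4)[OF unital] by blast
  qed
  then have "?C = B" using B(4) by blast
  then show ?thesis using B(1) by simp
qed

lemma finite_vars: "finite (vars m n)"
  by (simp add: vars_def)

lemma noetherian_subring_mpoly: "noetherian_subring {f :: 'k::field mpoly. in_vars m n f}"
proof (rule noetherian_subring_in_vars[of "var ` vars m n"])
  fix B :: "'k mpoly set" and v k
  assume B: "unital_subring B" "var ` vars m n \<subseteq> B" "v \<in> vars m n"
  show "Poly_Mapping.single (Poly_Mapping.single v k) 1 \<in> B"
  proof (induction k)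
    case (Suc k)
    have "var v * Poly_Mapping.single (Poly_Mapping.single v k) 1 \<in> B"
      using unital_subringD(5)[OF B(1)] B(2,3) Suc by blast
    then show ?case by (simp add: var_def mult_single single_add[symmetric])
  qed (use unital_subringD(1)[OF B(1)] in simp)
qed (auto simp: finite_vars in_vars_def var_def)

lemma noetherian_subring_laurent: "noetherian_subring {f :: 'k::field laurent. in_vars m n f}"
proof (rule noetherian_subring_in_vars)
  let ?T = "(\<lambda>(v, d). Poly_Mapping.single (Poly_Mapping.single v d) 1 :: 'k laurent) ` (vars m n \<times> {1, -1})"
  show "finite ?T" by (simp add: finite_vars)
  show "in_vars m n t" if "t \<in> ?T" for t using that by (auto simp: in_vars_def)
  fix B :: "'k laurent set" and v and k :: int
  assume B: "unital_subring B" "?T \<subseteq> B" "v \<in> vars m n"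
  have "Poly_Mapping.single (Poly_Mapping.single v (d * int i)) 1 \<in> B" if "d \<in> {1, -1}" for d i
  proof (induction i)
    case (Suc i)
    have "Poly_Mapping.single (Poly_Mapping.single v d) 1 *
        Poly_Mapping.single (Poly_Mapping.single v (d * int i)) 1 \<in> B"
      using B(2,3) that by (intro unital_subringD(5)[OF B(1)] Suc) auto
    then show ?case by (simp add: mult_single single_add[symmetric] algebra_simps)
  qed (use unital_subringD(1)[OF B(1)] in simp)
  \<comment> \<open>The sign of \<open>k\<close> decides between powers of the variable and of its
    inverse.\<close>
  from this[of 1 "nat k"] this[of "-1" "nat (- k)"]
  show "Poly_Mapping.single (Poly_Mapping.single v k) 1 \<in> B" by (cases "k \<ge> 0") simp_all
qed

theorem corollary7p3:
  fixes m n :: nat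
  shows
    "(\<forall>V I M. superalgebraic (algebra_S m n) (space_S m n) eval_S V
        \<and> I = vanishing_ideal (algebra_S m n) eval_S V
        \<and> M = minimal_primes_over (algebra_S m n :: ('k::{alg_closed_field, field_char_0}) mpoly ring) I
      \<longrightarrow> finite M
        \<and> (\<forall>P\<in>M. irreducible_superalgebraic (algebra_S m n) (space_S m n) eval_S
                    (zero_locus (space_S m n) eval_S P))
        \<and> V = (\<Union>P\<in>M. zero_locus (space_S m n) eval_S P)
        \<and> inj_on (zero_locus (space_S m n) eval_S) M
        \<and> (\<forall>\<C>. irredundant_irreducible_decomposition (algebra_S m n) (space_S m n) eval_S \<C> V
              \<longleftrightarrow> \<C> = zero_locus (space_S m n) eval_S ` M))
   \<and> (\<forall>V I M. superalgebraic (algebra_L m n) (space_L m n) eval_L V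
        \<and> I = vanishing_ideal (algebra_L m n) eval_L V
        \<and> M = minimal_primes_over (algebra_L m n :: 'k laurent ring) I
      \<longrightarrow> finite M
        \<and> (\<forall>P\<in>M. irreducible_superalgebraic (algebra_L m n) (space_L m n) eval_L
                    (zero_locus (space_L m n) eval_L P))
        \<and> V = (\<Union>P\<in>M. zero_locus (space_L m n) eval_L P)
        \<and> inj_on (zero_locus (space_L m n) eval_L) M
        \<and> (\<forall>\<C>. irredundant_irreducible_decomposition (algebra_L m n) (space_L m n) eval_L \<C> V
              \<longleftrightarrow> \<C> = zero_locus (space_L m n) eval_L ` M))"
proof -
  \<comment> \<open>In both cases the Noetherian ring \<open>B\<close> is the full ring of
    polynomials or Laurent polynomials in the admissible variables.\<close>
  interpret S: noetherian_evaluation "carrier (algebra_S m n :: 'k mpoly ring)"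
    "{f. in_vars m n f}" "space_S m n" eval_S
    by (rule noetherian_evaluation.intro[OF unital_subring_algebra_S noetherian_subring_mpoly])
      (auto simp: algebra_S_def eval_S_hom)
  interpret L: noetherian_evaluation "carrier (algebra_L m n :: 'k laurent ring)"
    "{f. in_vars m n f}" "space_L m n" eval_L
    by (rule noetherian_evaluation.intro[OF unital_subring_algebra_L noetherian_subring_laurent])
      (auto simp: algebra_L_def eval_L_hom)
  \<comment> \<open>The algebras already have the form of the locale's \<open>R\<close>, so these
    equations let its conclusions be read as statements about them.\<close>
  have "ring_of_type_algebra\<lparr>carrier := carrier (algebra_S m n)\<rparr> = (algebra_S m n :: 'k mpoly ring)"
    "ring_of_type_algebra\<lparr>carrier := carrier (algebra_L m n)\<rparr> = (algebra_L m n :: 'k laurent ring)"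
    by (simp_all add: algebra_S_def algebra_L_def)
  note S = S.minimal_primes_decomposition[unfolded this] and L = L.minimal_primes_decomposition[unfolded this]
  show ?thesis
    by (rule conjI; intro allI impI; elim conjE; rule S L; assumption)
qed

end
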